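(* Let $G=H+J$ be a finite group of triangular type over a finite field $k$, and let $G'=H'+J'$ be a subgroup of triangular type in $G$. Let $\phi$ be a superclass function on $G'$ and $\psi$ a superclass function on $G$. Then $$(\mathrm{SInd}\,\phi,\psi)=(\phi,\mathrm{Res}\,\psi),$$ where $\mathrm{SInd}\,\phi$ is the superinduction of $\phi$ to $G$, $\mathrm{Res}\,\psi$ is the restriction of $\psi$ to $G'$, and the left- and right-hand scalar products are those on $G$ and on $G'$ respectively.
   Context: **Finite groups of triangular type.** Let $k=\mathbb F_q$ be a finite field, $J$ a finite-dimensional associative nilpotent $k$-algebra, and $H$ a finite abelian group with $\mathrm{char}\,k\nmid |H|$. Assume $H$ acts $k$-linearly on $J$ on the left, $(h,x)\mapsto hx$, and on the right, $(h,x)\mapsto xh$, the two actions commute ($(hx)h'=h(xh')$), and for all $h\in H$, $x,y\in J$: $h(xy)=(hx)y$, $(xy)h=x(yh)$, $x(hy)=(xh)y$. Then $A=kH\oplus J$ is an associative unital algebra with multiplication extending $(h_1+x_1)(h_2+x_2)=h_1h_2+h_1x_2+x_1h_2+x_1x_2$, and $G=H+J=\{h+x: h\in H,\ x\in J\}\subset A$ is a finite group under this multiplication, called a finite group of triangular type. Put $N=1+J$. **Subgroups of triangular type.** If $H'$ is a subgroup of $H$ and $J'$ is a subalgebra of $J$ invariant under left and right multiplication by $H'$, then $G'=H'+J'$ is a subgroup of $G$, called a subgroup of triangular type. It is itself a finite group of triangular type (with data $H',J'$), and its superclasses are defined as below with $(H',J')$ in place of $(H,J)$. **Superclasses.** Let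 $\widetilde G$ be the set of triples $\tau=(t,a,b)$, $t\in H$, $a,b\in N$, with the group operation $(t_1,a_1,b_1)(t_2,a_2,b_2)=(t_1t_2,\ t_2^{-1}a_1t_2a_2,\ t_2^{-1}b_1t_2b_2)$. It acts on $G$ by $R_\tau(g)=1+ta(g-1)b^{-1}t^{-1}$ (computed in $A$; the result lies in $G$). The $\widetilde G$-orbits in $G$ are called superclasses. A superclass function on $G$ is a complex-valued function on $G$ constant on superclasses. **Superinduction.** For a superclass function $\phi$ on $G'$, let $\dot\phi$ be the function on $G$ equal to $\phi$ on $G'$ and to zero outside $G'$. The superinduction of $\phi$ is the function on $G$ $$\mathrm{SInd}\,\phi(g)=\frac{|H|}{|G|\cdot|G'|}\sum_{\tau\in\widetilde G}\dot\phi(R_\tau(g))=\frac{|H|}{|G|\cdot|G'|}\sum_{a,b\in N,\ t\in H}\dot\phi\bigl(1+ta(g-1)bt^{-1}\bigr).$$ **Scalar product.** On $G$: $(f_1,f_2)=\frac1{|G|}\sum_{g\in G}f_1(g)\overline{f_2(g)}$, and on $G'$: $(f_1,f_2)=\frac1{|G'|}\sum_{g\in G'}f_1(g)\overline{f_2(g)}$. *)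

theory Defs
  imports
    "HOL-Algebra.Group_Action"
    "HOL-Algebra.Multiplicative_Group"
    "Jordan_Normal_Form.Missing_VectorSpace"
    Complex_Main
begin

text \<open>
  \<open>J\<close> is an HOL-Algebra module record; its field \<open>one\<close> is never used, since a nilpotent algebra has
  no unit. \<open>la h x\<close> is the left action $hx$ and \<open>ra x h\<close> is the right action $xh$. The constructions
  below are made for arbitrary data, without assumptions, so that they can be applied verbatim both to
  $(H, J)$ and to $(H', J')$.
\<close>

locale triangular_data =
  fixes K :: "('k, 'm) ring_scheme"
    and H :: "('h, 'n) monoid_scheme"
    and J :: "('k, 'j, 'p) module_scheme"
    and la :: "'h \<Rightarrow> 'j \<Rightarrow> 'j"
    and ra :: "'j \<Rightarrow> 'h \<Rightarrow> 'j"
begin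

text \<open>
  Elements of $kH$ are functions \<open>'h \<Rightarrow> 'k\<close> vanishing outside \<open>carrier H\<close> (rather than undefined
  there), so that $kH'$ is literally a subset of $kH$ for a subgroup $H'$ of $H$.
\<close>

definition kH_carrier :: "('h \<Rightarrow> 'k) set" where
  "kH_carrier = {f. (\<forall>h\<in>carrier H. f h \<in> carrier K) \<and> (\<forall>h. h \<notin> carrier H \<longrightarrow> f h = \<zero>\<^bsub>K\<^esub>)}"

definition kH_mult :: "('h \<Rightarrow> 'k) \<Rightarrow> ('h \<Rightarrow> 'k) \<Rightarrow> 'h \<Rightarrow> 'k" where
  "kH_mult f g = (\<lambda>x. if x \<in> carrier H
     then \<Oplus>\<^bsub>K\<^esub>y\<in>carrier H. f y \<otimes>\<^bsub>K\<^esub> g (inv\<^bsub>H\<^esub> y \<otimes>\<^bsub>H\<^esub> x) else \<zero>\<^bsub>K\<^esub>)"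

definition kH_single :: "'h \<Rightarrow> 'h \<Rightarrow> 'k" where
  "kH_single h = (\<lambda>x. if x = h then \<one>\<^bsub>K\<^esub> else \<zero>\<^bsub>K\<^esub>)"

definition kH_la :: "('h \<Rightarrow> 'k) \<Rightarrow> 'j \<Rightarrow> 'j" where
  "kH_la f x = (\<Oplus>\<^bsub>J\<^esub>h\<in>carrier H. f h \<odot>\<^bsub>J\<^esub> la h x)"

definition kH_ra :: "'j \<Rightarrow> ('h \<Rightarrow> 'k) \<Rightarrow> 'j" where
  "kH_ra x f = (\<Oplus>\<^bsub>J\<^esub>h\<in>carrier H. f h \<odot>\<^bsub>J\<^esub> ra x h)"

text \<open>The algebra $A = kH \oplus J$.\<close>

definition A :: "('k, ('h \<Rightarrow> 'k) \<times> 'j) module" where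
  "A = \<lparr>carrier = kH_carrier \<times> carrier J,
        mult = (\<lambda>(f, x) (g, y).
          (kH_mult f g, kH_la f y \<oplus>\<^bsub>J\<^esub> kH_ra x g \<oplus>\<^bsub>J\<^esub> x \<otimes>\<^bsub>J\<^esub> y)),
        one = (kH_single \<one>\<^bsub>H\<^esub>, \<zero>\<^bsub>J\<^esub>),
        zero = ((\<lambda>_. \<zero>\<^bsub>K\<^esub>), \<zero>\<^bsub>J\<^esub>),
        add = (\<lambda>(f, x) (g, y). ((\<lambda>h. f h \<oplus>\<^bsub>K\<^esub> g h), x \<oplus>\<^bsub>J\<^esub> y)),
        smult = (\<lambda>c (f, x). ((\<lambda>h. c \<otimes>\<^bsub>K\<^esub> f h), c \<odot>\<^bsub>J\<^esub> x))\<rparr>"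

definition of_H :: "'h \<Rightarrow> ('h \<Rightarrow> 'k) \<times> 'j" where
  "of_H h = (kH_single h, \<zero>\<^bsub>J\<^esub>)"

definition of_J :: "'j \<Rightarrow> ('h \<Rightarrow> 'k) \<times> 'j" where
  "of_J x = ((\<lambda>_. \<zero>\<^bsub>K\<^esub>), x)"

definition G :: "(('h \<Rightarrow> 'k) \<times> 'j) monoid" where
  "G = \<lparr>carrier = {of_H h \<oplus>\<^bsub>A\<^esub> of_J x | h x. h \<in> carrier H \<and> x \<in> carrier J},
        mult = mult A, one = one A\<rparr>"

definition N :: "(('h \<Rightarrow> 'k) \<times> 'j) set" where
  "N = {\<one>\<^bsub>A\<^esub> \<oplus>\<^bsub>A\<^esub> of_J x | x. x \<in> carrier J}"

definition G_tilde :: "('h \<times> (('h \<Rightarrow> 'k) \<times> 'j) \<times> (('h \<Rightarrow> 'k) \<times> 'j)) monoid" where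
  "G_tilde = \<lparr>carrier = carrier H \<times> N \<times> N,
     mult = (\<lambda>(t1, a1, b1) (t2, a2, b2).
       (t1 \<otimes>\<^bsub>H\<^esub> t2,
        inv\<^bsub>A\<^esub> (of_H t2) \<otimes>\<^bsub>A\<^esub> a1 \<otimes>\<^bsub>A\<^esub> of_H t2 \<otimes>\<^bsub>A\<^esub> a2,
        inv\<^bsub>A\<^esub> (of_H t2) \<otimes>\<^bsub>A\<^esub> b1 \<otimes>\<^bsub>A\<^esub> of_H t2 \<otimes>\<^bsub>A\<^esub> b2)),
     one = (\<one>\<^bsub>H\<^esub>, \<one>\<^bsub>A\<^esub>, \<one>\<^bsub>A\<^esub>)\<rparr>"

definition R :: "'h \<times> (('h \<Rightarrow> 'k) \<times> 'j) \<times> (('h \<Rightarrow> 'k) \<times> 'j)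
    \<Rightarrow> ('h \<Rightarrow> 'k) \<times> 'j \<Rightarrow> ('h \<Rightarrow> 'k) \<times> 'j" where
  "R = (\<lambda>(t, a, b) g.
     \<one>\<^bsub>A\<^esub> \<oplus>\<^bsub>A\<^esub> of_H t \<otimes>\<^bsub>A\<^esub> a \<otimes>\<^bsub>A\<^esub> (g \<ominus>\<^bsub>A\<^esub> \<one>\<^bsub>A\<^esub>) \<otimes>\<^bsub>A\<^esub> inv\<^bsub>A\<^esub> b \<otimes>\<^bsub>A\<^esub> inv\<^bsub>A\<^esub> (of_H t))"

definition superclasses :: "(('h \<Rightarrow> 'k) \<times> 'j) set set" where
  "superclasses = orbits G_tilde (carrier G) R"

text \<open>
  Functions on $G$ are total functions on the ambient type of $A$; their values outside
  \<open>carrier G\<close> are irrelevant.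
\<close>

definition superclass_function :: "(('h \<Rightarrow> 'k) \<times> 'j \<Rightarrow> complex) \<Rightarrow> bool" where
  "superclass_function f \<longleftrightarrow> (\<forall>C\<in>superclasses. \<forall>g1\<in>C. \<forall>g2\<in>C. f g1 = f g2)"

definition scalar_product ::
    "(('h \<Rightarrow> 'k) \<times> 'j \<Rightarrow> complex) \<Rightarrow> (('h \<Rightarrow> 'k) \<times> 'j \<Rightarrow> complex) \<Rightarrow> complex" where
  "scalar_product f1 f2 = 1 / of_nat (order G) * (\<Sum>g\<in>carrier G. f1 g * cnj (f2 g))"

end

text \<open>
  The characteristic of \<open>K\<close> is the additive order of \<open>\<one>\<close>. In \<open>nilpotent\<close>, the left-nested
  product has \<open>length xs + 1\<close> factors.
\<close>

locale triangular_type =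
  triangular_data K H J la ra + vectorspace K J + H: comm_group H
  for K :: "('k, 'm) ring_scheme"
    and H :: "('h, 'n) monoid_scheme"
    and J :: "('k, 'j, 'p) module_scheme"
    and la :: "'h \<Rightarrow> 'j \<Rightarrow> 'j"
    and ra :: "'j \<Rightarrow> 'h \<Rightarrow> 'j" +
  assumes finite_K: "finite (carrier K)"
    and finite_H: "finite (carrier H)"
    and char_H: "\<not> group.ord (add_monoid K) \<one>\<^bsub>K\<^esub> dvd order H"
    and fin_dim_J: "fin_dim"
    and J_mult_closed: "\<lbrakk>x \<in> carrier J; y \<in> carrier J\<rbrakk> \<Longrightarrow> x \<otimes>\<^bsub>J\<^esub> y \<in> carrier J"
    and J_assoc: "\<lbrakk>x \<in> carrier J; y \<in> carrier J; z \<in> carrier J\<rbrakk> \<Longrightarrow>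
      (x \<otimes>\<^bsub>J\<^esub> y) \<otimes>\<^bsub>J\<^esub> z = x \<otimes>\<^bsub>J\<^esub> (y \<otimes>\<^bsub>J\<^esub> z)"
    and J_l_distr: "\<lbrakk>x \<in> carrier J; y \<in> carrier J; z \<in> carrier J\<rbrakk> \<Longrightarrow>
      (x \<oplus>\<^bsub>J\<^esub> y) \<otimes>\<^bsub>J\<^esub> z = x \<otimes>\<^bsub>J\<^esub> z \<oplus>\<^bsub>J\<^esub> y \<otimes>\<^bsub>J\<^esub> z"
    and J_r_distr: "\<lbrakk>x \<in> carrier J; y \<in> carrier J; z \<in> carrier J\<rbrakk> \<Longrightarrow>
      x \<otimes>\<^bsub>J\<^esub> (y \<oplus>\<^bsub>J\<^esub> z) = x \<otimes>\<^bsub>J\<^esub> y \<oplus>\<^bsub>J\<^esub> x \<otimes>\<^bsub>J\<^esub> z"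
    and J_smult_l: "\<lbrakk>c \<in> carrier K; x \<in> carrier J; y \<in> carrier J\<rbrakk> \<Longrightarrow>
      (c \<odot>\<^bsub>J\<^esub> x) \<otimes>\<^bsub>J\<^esub> y = c \<odot>\<^bsub>J\<^esub> (x \<otimes>\<^bsub>J\<^esub> y)"
    and J_smult_r: "\<lbrakk>c \<in> carrier K; x \<in> carrier J; y \<in> carrier J\<rbrakk> \<Longrightarrow>
      x \<otimes>\<^bsub>J\<^esub> (c \<odot>\<^bsub>J\<^esub> y) = c \<odot>\<^bsub>J\<^esub> (x \<otimes>\<^bsub>J\<^esub> y)"
    and nilpotent: "\<exists>n. \<forall>x xs. x \<in> carrier J \<and> set xs \<subseteq> carrier J \<and> length xs = n \<longrightarrow>
      foldl (\<lambda>y z. y \<otimes>\<^bsub>J\<^esub> z) x xs = \<zero>\<^bsub>J\<^esub>"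
    and la_closed: "\<lbrakk>h \<in> carrier H; x \<in> carrier J\<rbrakk> \<Longrightarrow> la h x \<in> carrier J"
    and la_add: "\<lbrakk>h \<in> carrier H; x \<in> carrier J; y \<in> carrier J\<rbrakk> \<Longrightarrow>
      la h (x \<oplus>\<^bsub>J\<^esub> y) = la h x \<oplus>\<^bsub>J\<^esub> la h y"
    and la_smult: "\<lbrakk>h \<in> carrier H; c \<in> carrier K; x \<in> carrier J\<rbrakk> \<Longrightarrow>
      la h (c \<odot>\<^bsub>J\<^esub> x) = c \<odot>\<^bsub>J\<^esub> la h x"
    and la_one: "x \<in> carrier J \<Longrightarrow> la \<one>\<^bsub>H\<^esub> x = x"
    and la_mult: "\<lbrakk>h \<in> carrier H; h' \<in> carrier H; x \<in> carrier J\<rbrakk> \<Longrightarrow>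
      la (h \<otimes>\<^bsub>H\<^esub> h') x = la h (la h' x)"
    and ra_closed: "\<lbrakk>h \<in> carrier H; x \<in> carrier J\<rbrakk> \<Longrightarrow> ra x h \<in> carrier J"
    and ra_add: "\<lbrakk>h \<in> carrier H; x \<in> carrier J; y \<in> carrier J\<rbrakk> \<Longrightarrow>
      ra (x \<oplus>\<^bsub>J\<^esub> y) h = ra x h \<oplus>\<^bsub>J\<^esub> ra y h"
    and ra_smult: "\<lbrakk>h \<in> carrier H; c \<in> carrier K; x \<in> carrier J\<rbrakk> \<Longrightarrow>
      ra (c \<odot>\<^bsub>J\<^esub> x) h = c \<odot>\<^bsub>J\<^esub> ra x h"
    and ra_one: "x \<in> carrier J \<Longrightarrow> ra x \<one>\<^bsub>H\<^esub> = x"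
    and ra_mult: "\<lbrakk>h \<in> carrier H; h' \<in> carrier H; x \<in> carrier J\<rbrakk> \<Longrightarrow>
      ra x (h \<otimes>\<^bsub>H\<^esub> h') = ra (ra x h) h'"
    and la_ra: "\<lbrakk>h \<in> carrier H; h' \<in> carrier H; x \<in> carrier J\<rbrakk> \<Longrightarrow>
      ra (la h x) h' = la h (ra x h')"
    and la_J_mult: "\<lbrakk>h \<in> carrier H; x \<in> carrier J; y \<in> carrier J\<rbrakk> \<Longrightarrow>
      la h (x \<otimes>\<^bsub>J\<^esub> y) = la h x \<otimes>\<^bsub>J\<^esub> y"
    and ra_J_mult: "\<lbrakk>h \<in> carrier H; x \<in> carrier J; y \<in> carrier J\<rbrakk> \<Longrightarrow>
      ra (x \<otimes>\<^bsub>J\<^esub> y) h = x \<otimes>\<^bsub>J\<^esub> ra y h"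
    and J_mult_la: "\<lbrakk>h \<in> carrier H; x \<in> carrier J; y \<in> carrier J\<rbrakk> \<Longrightarrow>
      x \<otimes>\<^bsub>J\<^esub> la h y = ra x h \<otimes>\<^bsub>J\<^esub> y"

text \<open>
  The product on \<open>A\<close>, restricted to sums $h + x$, is the formula
  $(h_1+x_1)(h_2+x_2)=h_1h_2+h_1x_2+x_1h_2+x_1x_2$.
\<close>

context triangular_type
begin

lemma kH_single_mult:
  assumes "h1 \<in> carrier H" "h2 \<in> carrier H"
  shows "kH_mult (kH_single h1) (kH_single h2) = kH_single (h1 \<otimes>\<^bsub>H\<^esub> h2)"
proof
  fix x
  show "kH_mult (kH_single h1) (kH_single h2) x = kH_single (h1 \<otimes>\<^bsub>H\<^esub> h2) x"
  proof (cases "x \<in> carrier H")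
    case True
    have "kH_mult (kH_single h1) (kH_single h2) x =
        (\<Oplus>\<^bsub>K\<^esub>y\<in>carrier H. if h1 = y then kH_single h2 (inv\<^bsub>H\<^esub> y \<otimes>\<^bsub>H\<^esub> x) else \<zero>\<^bsub>K\<^esub>)"
      unfolding kH_mult_def using True
      by (auto intro!: R.finsum_cong' simp: kH_single_def)
    also have "\<dots> = kH_single h2 (inv\<^bsub>H\<^esub> h1 \<otimes>\<^bsub>H\<^esub> x)"
      using assms(1) finite_H by (rule R.finsum_singleton) (auto simp: kH_single_def)
    also have "\<dots> = kH_single (h1 \<otimes>\<^bsub>H\<^esub> h2) x"
      using assms True H.inv_solve_left' H.inv_solve_left by (auto simp: kH_single_def)
    finally show ?thesis .
  qed (use assms in \<open>auto simp: kH_mult_def kH_single_def\<close>)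
qed

lemma kH_la_single:
  assumes "h \<in> carrier H" "x \<in> carrier J"
  shows "kH_la (kH_single h) x = la h x"
proof -
  have "kH_la (kH_single h) x = (\<Oplus>\<^bsub>J\<^esub>y\<in>carrier H. if h = y then la y x else \<zero>\<^bsub>J\<^esub>)"
    unfolding kH_la_def using assms la_closed by (auto intro!: M.finsum_cong' simp: kH_single_def)
  also have "\<dots> = la h x"
    using assms(1) finite_H by (rule M.finsum_singleton) (use assms la_closed in auto)
  finally show ?thesis .
qed

lemma kH_ra_single:
  assumes "h \<in> carrier H" "x \<in> carrier J"
  shows "kH_ra x (kH_single h) = ra x h"
proof -
  have "kH_ra x (kH_single h) = (\<Oplus>\<^bsub>J\<^esub>y\<in>carrier H. if h = y then ra x y else \<zero>\<^bsub>J\<^esub>)"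
    unfolding kH_ra_def using assms ra_closed by (auto intro!: M.finsum_cong' simp: kH_single_def)
  also have "\<dots> = ra x h"
    using assms(1) finite_H by (rule M.finsum_singleton) (use assms ra_closed in auto)
  finally show ?thesis .
qed

lemma A_mult_eq:
  assumes "h1 \<in> carrier H" "h2 \<in> carrier H" "x1 \<in> carrier J" "x2 \<in> carrier J"
  shows "(of_H h1 \<oplus>\<^bsub>A\<^esub> of_J x1) \<otimes>\<^bsub>A\<^esub> (of_H h2 \<oplus>\<^bsub>A\<^esub> of_J x2) =
    of_H (h1 \<otimes>\<^bsub>H\<^esub> h2) \<oplus>\<^bsub>A\<^esub> of_J (la h1 x2 \<oplus>\<^bsub>J\<^esub> ra x1 h2 \<oplus>\<^bsub>J\<^esub> x1 \<otimes>\<^bsub>J\<^esub> x2)"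
proof -
  have s: "(\<lambda>a. kH_single h a \<oplus>\<^bsub>K\<^esub> \<zero>\<^bsub>K\<^esub>) = kH_single h" for h
    by (auto simp: kH_single_def)
  show ?thesis
    using assms la_closed ra_closed J_mult_closed
    by (simp add: A_def of_H_def of_J_def s kH_single_mult kH_la_single kH_ra_single)
qed

end

locale triangular_subgroup = triangular_type K H J la ra
  for K :: "('k, 'm) ring_scheme"
    and H :: "('h, 'n) monoid_scheme"
    and J :: "('k, 'j, 'p) module_scheme"
    and la :: "'h \<Rightarrow> 'j \<Rightarrow> 'j"
    and ra :: "'j \<Rightarrow> 'h \<Rightarrow> 'j" +
  fixes H' :: "'h set" and J' :: "'j set"
  assumes H'_subgroup: "subgroup H' H"
    and J'_subspace: "subspace K J' J"
    and J'_mult_closed: "\<lbrakk>x \<in> J'; y \<in> J'\<rbrakk> \<Longrightarrow> x \<otimes>\<^bsub>J\<^esub> y \<in> J'"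
    and J'_la_closed: "\<lbrakk>h \<in> H'; x \<in> J'\<rbrakk> \<Longrightarrow> la h x \<in> J'"
    and J'_ra_closed: "\<lbrakk>h \<in> H'; x \<in> J'\<rbrakk> \<Longrightarrow> ra x h \<in> J'"

context triangular_data
begin

definition sub_G :: "'h set \<Rightarrow> 'j set \<Rightarrow> (('h \<Rightarrow> 'k) \<times> 'j) monoid" where
  "sub_G H' J' = triangular_data.G K (H\<lparr>carrier := H'\<rparr>) (J\<lparr>carrier := J'\<rparr>) la ra"

definition sub_superclass_function ::
    "'h set \<Rightarrow> 'j set \<Rightarrow> (('h \<Rightarrow> 'k) \<times> 'j \<Rightarrow> complex) \<Rightarrow> bool" where
  "sub_superclass_function H' J' =
     triangular_data.superclass_function K (H\<lparr>carrier := H'\<rparr>) (J\<lparr>carrier := J'\<rparr>) la ra"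

definition sub_scalar_product :: "'h set \<Rightarrow> 'j set \<Rightarrow>
    (('h \<Rightarrow> 'k) \<times> 'j \<Rightarrow> complex) \<Rightarrow> (('h \<Rightarrow> 'k) \<times> 'j \<Rightarrow> complex) \<Rightarrow> complex" where
  "sub_scalar_product H' J' =
     triangular_data.scalar_product K (H\<lparr>carrier := H'\<rparr>) (J\<lparr>carrier := J'\<rparr>) la ra"

definition SInd :: "'h set \<Rightarrow> 'j set \<Rightarrow>
    (('h \<Rightarrow> 'k) \<times> 'j \<Rightarrow> complex) \<Rightarrow> ('h \<Rightarrow> 'k) \<times> 'j \<Rightarrow> complex" where
  "SInd H' J' \<phi> = (\<lambda>g\<in>carrier G.
     of_nat (order H) / (of_nat (order G) * of_nat (order (sub_G H' J'))) *
     (\<Sum>\<tau>\<in>carrier G_tilde.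
        (\<lambda>g'. if g' \<in> carrier (sub_G H' J') then \<phi> g' else 0) (R \<tau> g)))"

definition Res :: "'h set \<Rightarrow> 'j set \<Rightarrow>
    (('h \<Rightarrow> 'k) \<times> 'j \<Rightarrow> complex) \<Rightarrow> ('h \<Rightarrow> 'k) \<times> 'j \<Rightarrow> complex" where
  "Res H' J' \<psi> = restrict \<psi> (carrier (sub_G H' J'))"

end

end

theory Submission
  imports Defs
begin

text \<open>
  Each $R_\tau$ is a bijection of $G$ under which $\psi$ is invariant, so every $\tau$ contributes
  the same amount $\sum_{g\in G'}\phi(g)\overline{\psi(g)}$ to $(\mathrm{SInd}\,\phi,\psi)$; the
  normalisation then reduces to $|H|\,|\widetilde G| = |G|^2$. In coordinates, $R_\tau$ fixes the
  $H$-component of $h + x$ and acts on $x$ by an affine map, whose injectivity comes from the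
  invertibility of elements of $N$, i.e. from nilpotency of $J$.
\<close>

section \<open>Coordinates on \<open>A\<close> and the group 1 + J\<close>

context triangular_data
begin

lemma A_carrier: "carrier A = kH_carrier \<times> carrier J"
  and A_one: "\<one>\<^bsub>A\<^esub> = (kH_single \<one>\<^bsub>H\<^esub>, \<zero>\<^bsub>J\<^esub>)"
  and A_add: "(f, x) \<oplus>\<^bsub>A\<^esub> (g, y) = ((\<lambda>h. f h \<oplus>\<^bsub>K\<^esub> g h), x \<oplus>\<^bsub>J\<^esub> y)"
  and A_mult: "(f, x) \<otimes>\<^bsub>A\<^esub> (g, y) =
    (kH_mult f g, kH_la f y \<oplus>\<^bsub>J\<^esub> kH_ra x g \<oplus>\<^bsub>J\<^esub> x \<otimes>\<^bsub>J\<^esub> y)"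
  by (simp_all add: A_def)

text \<open>The group $N = 1 + J$ transported to $J$ along $x \mapsto 1 + x$.\<close>

definition J_circ :: "'j monoid" where
  "J_circ = \<lparr>carrier = carrier J, mult = (\<lambda>x y. x \<oplus>\<^bsub>J\<^esub> y \<oplus>\<^bsub>J\<^esub> x \<otimes>\<^bsub>J\<^esub> y), one = \<zero>\<^bsub>J\<^esub>\<rparr>"

lemma J_circ_simps:
  "carrier J_circ = carrier J"
  "x \<otimes>\<^bsub>J_circ\<^esub> y = x \<oplus>\<^bsub>J\<^esub> y \<oplus>\<^bsub>J\<^esub> x \<otimes>\<^bsub>J\<^esub> y"
  "\<one>\<^bsub>J_circ\<^esub> = \<zero>\<^bsub>J\<^esub>"
  by (simp_all add: J_circ_def)

end

context triangular_type
begin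

section \<open>Finiteness of J, zero rules, injectivity of the actions\<close>

lemma finite_J: "finite (carrier J)"
proof -
  obtain B where B: "finite B" "B \<subseteq> carrier J" "gen_set B"
    using fin_dim_J unfolding fin_dim_def by blast
  have "carrier J \<subseteq> (\<lambda>a. lincomb a B) ` (B \<rightarrow>\<^sub>E carrier K)"
  proof
    fix x assume "x \<in> carrier J"
    then obtain a where a: "x = lincomb a B" "a \<in> B \<rightarrow> carrier K"
      using B(3) finite_span[OF B(1,2)] by blast
    \<comment> \<open>Values of \<open>a\<close> off \<open>B\<close> do not enter the combination.
      Restricting \<open>a\<close> makes it extensional, so it lies in the finite set
      \<open>B \<rightarrow>\<^sub>E carrier K\<close>.\<close>
    have "lincomb (restrict a B) B = lincomb a B"
      unfolding lincomb_def using a(2) B(2) by (intro M.finsum_cong') auto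
    then show "x \<in> (\<lambda>a. lincomb a B) ` (B \<rightarrow>\<^sub>E carrier K)"
      using a by (intro image_eqI[where x = "restrict a B"]) auto
  qed
  then show ?thesis
    using B(1) finite_K by (meson finite_PiE finite_imageI finite_subset)
qed

lemma J_mult_zero:
  assumes "x \<in> carrier J"
  shows "\<zero>\<^bsub>J\<^esub> \<otimes>\<^bsub>J\<^esub> x = \<zero>\<^bsub>J\<^esub>" "x \<otimes>\<^bsub>J\<^esub> \<zero>\<^bsub>J\<^esub> = \<zero>\<^bsub>J\<^esub>"
proof -
  show "\<zero>\<^bsub>J\<^esub> \<otimes>\<^bsub>J\<^esub> x = \<zero>\<^bsub>J\<^esub>"
    using J_l_distr[of "\<zero>\<^bsub>J\<^esub>" "\<zero>\<^bsub>J\<^esub>" x] assms J_mult_closed by simp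
  show "x \<otimes>\<^bsub>J\<^esub> \<zero>\<^bsub>J\<^esub> = \<zero>\<^bsub>J\<^esub>"
    using J_r_distr[of x "\<zero>\<^bsub>J\<^esub>" "\<zero>\<^bsub>J\<^esub>"] assms J_mult_closed by simp
qed

lemma la_zero: "h \<in> carrier H \<Longrightarrow> la h \<zero>\<^bsub>J\<^esub> = \<zero>\<^bsub>J\<^esub>"
  using la_add[of h "\<zero>\<^bsub>J\<^esub>" "\<zero>\<^bsub>J\<^esub>"] la_closed by simp

lemma ra_zero: "h \<in> carrier H \<Longrightarrow> ra \<zero>\<^bsub>J\<^esub> h = \<zero>\<^bsub>J\<^esub>"
  using ra_add[of h "\<zero>\<^bsub>J\<^esub>" "\<zero>\<^bsub>J\<^esub>"] ra_closed by simp

lemma inj_on_la: "h \<in> carrier H \<Longrightarrow> inj_on (la h) (carrier J)"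
  by (rule inj_on_inverseI[where g = "la (inv\<^bsub>H\<^esub> h)"]) (simp add: la_mult[symmetric] la_one)

lemma inj_on_ra: "h \<in> carrier H \<Longrightarrow> inj_on (\<lambda>x. ra x h) (carrier J)"
  by (rule inj_on_inverseI[where g = "\<lambda>x. ra x (inv\<^bsub>H\<^esub> h)"]) (simp add: ra_mult[symmetric] ra_one)

section \<open>Quasi-inverses in J and injectivity of multiplication by 1 + u\<close>

text \<open>
  The partial sums of the geometric series of \<open>-w\<close> are eventually constant by nilpotency,
  and their limit is a left quasi-inverse of \<open>w\<close>.
\<close>

lemma left_quasi_inverse_ex:
  assumes w: "w \<in> carrier J"
  shows "\<exists>z\<in>carrier J. z \<oplus>\<^bsub>J\<^esub> w \<oplus>\<^bsub>J\<^esub> z \<otimes>\<^bsub>J\<^esub> w = \<zero>\<^bsub>J\<^esub>"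
proof -
  define v where "v = \<ominus>\<^bsub>J\<^esub> w"
  \<comment> \<open>\<open>d k\<close> is v^(k+1): the fold starts at v, so k listed factors give k
    + 1 in all, the same count as in \<open>nilpotent\<close>.\<close>
  define d where "d k = foldl (\<lambda>y z. y \<otimes>\<^bsub>J\<^esub> z) v (replicate k v)" for k
  \<comment> \<open>Horner form of v + v^2 + ... + v^k, starting from the empty sum at k = 0. Closed
    under this recursion, a stationary value z satisfies z = v + zv.\<close>
  define p where "p = rec_nat \<zero>\<^bsub>J\<^esub> (\<lambda>_ z. v \<oplus>\<^bsub>J\<^esub> z \<otimes>\<^bsub>J\<^esub> v)"
  have p0: "p 0 = \<zero>\<^bsub>J\<^esub>" and pS: "\<And>k. p (Suc k) = v \<oplus>\<^bsub>J\<^esub> p k \<otimes>\<^bsub>J\<^esub> v"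
    by (simp_all add: p_def)
  have v: "v \<in> carrier J" using w by (simp add: v_def)
  have d0: "d 0 = v" by (simp add: d_def)
  have dS: "d (Suc k) = d k \<otimes>\<^bsub>J\<^esub> v" for k
    unfolding d_def replicate_Suc replicate_append_same[symmetric] by simp
  have d: "d k \<in> carrier J" for k
    by (induction k) (use v J_mult_closed in \<open>auto simp: d0 dS\<close>)
  have p: "p k \<in> carrier J" for k
    by (induction k) (use v J_mult_closed in \<open>auto simp: p0 pS\<close>)
  have step: "p (Suc k) = p k \<oplus>\<^bsub>J\<^esub> d k" for k
  proof (induction k)
    case 0
    then show ?case using v by (simp add: p0 pS d0 J_mult_zero)
  next
    case (Suc k)
    have "p (Suc (Suc k)) = v \<oplus>\<^bsub>J\<^esub> (p k \<oplus>\<^bsub>J\<^esub> d k) \<otimes>\<^bsub>J\<^esub> v"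
      by (subst pS) (simp add: Suc)
    also have "\<dots> = (v \<oplus>\<^bsub>J\<^esub> p k \<otimes>\<^bsub>J\<^esub> v) \<oplus>\<^bsub>J\<^esub> d (Suc k)"
      using v p d J_mult_closed by (simp add: J_l_distr dS M.a_assoc)
    finally show ?case by (simp add: pS)
  qed
  obtain n where n: "\<And>x xs. x \<in> carrier J \<and> set xs \<subseteq> carrier J \<and> length xs = n \<Longrightarrow>
      foldl (\<lambda>y z. y \<otimes>\<^bsub>J\<^esub> z) x xs = \<zero>\<^bsub>J\<^esub>"
    using nilpotent by blast
  have "d n = \<zero>\<^bsub>J\<^esub>"
    unfolding d_def by (rule n) (use v in auto)
  \<comment> \<open>The increment from \<open>p n\<close> to \<open>p (Suc n)\<close> is
    \<open>d n\<close>, which vanishes, so \<open>p n\<close> is a fixed point of the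
    recursion.\<close>
  then have fix_p: "p n = v \<oplus>\<^bsub>J\<^esub> p n \<otimes>\<^bsub>J\<^esub> v"
    using step[of n] pS[of n] p[of n] by simp
  have "v \<oplus>\<^bsub>J\<^esub> w = \<zero>\<^bsub>J\<^esub>" using w by (simp add: v_def M.l_neg)
  moreover have "p n \<otimes>\<^bsub>J\<^esub> v \<oplus>\<^bsub>J\<^esub> p n \<otimes>\<^bsub>J\<^esub> w = \<zero>\<^bsub>J\<^esub>"
    using J_r_distr[OF p v w] calculation p J_mult_zero by simp
  \<comment> \<open>Only the leading \<open>p n\<close> is replaced by v + (p n)v. The terms then
    pair into v + w and (p n)(v + w), both zero.\<close>
  moreover have "p n \<oplus>\<^bsub>J\<^esub> w \<oplus>\<^bsub>J\<^esub> p n \<otimes>\<^bsub>J\<^esub> w =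
      (v \<oplus>\<^bsub>J\<^esub> w) \<oplus>\<^bsub>J\<^esub> (p n \<otimes>\<^bsub>J\<^esub> v \<oplus>\<^bsub>J\<^esub> p n \<otimes>\<^bsub>J\<^esub> w)"
    by (subst (1) fix_p) (use p v w J_mult_closed in \<open>simp add: M.a_ac\<close>)
  ultimately show ?thesis using p by auto
qed

text \<open>Associativity is that of (1+x)(1+y)(1+z) expanded. The rule \<open>groupI\<close> asks
  only for left units and left inverses, so left quasi-inverses suffice.\<close>

lemma group_J_circ: "group J_circ"
proof (rule groupI)
  show "x \<otimes>\<^bsub>J_circ\<^esub> y \<otimes>\<^bsub>J_circ\<^esub> z = x \<otimes>\<^bsub>J_circ\<^esub> (y \<otimes>\<^bsub>J_circ\<^esub> z)"
    if "x \<in> carrier J_circ" "y \<in> carrier J_circ" "z \<in> carrier J_circ" for x y z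
    using that J_mult_closed
    by (simp add: J_circ_simps J_l_distr J_r_distr J_assoc M.a_ac)
qed (use J_mult_closed left_quasi_inverse_ex in \<open>auto simp: J_circ_simps J_mult_zero\<close>)

text \<open>The map is left multiplication by 1 + u. It differs from the circle product of u and x
  by the constant u, so cancellation in \<open>J_circ\<close> applies. The right-hand version below
  is its mirror image.\<close>

lemma inj_on_J_plus_mult_left:
  assumes "u \<in> carrier J"
  shows "inj_on (\<lambda>x. x \<oplus>\<^bsub>J\<^esub> u \<otimes>\<^bsub>J\<^esub> x) (carrier J)"
proof (rule inj_onI)
  interpret C: group J_circ by (rule group_J_circ)
  fix x y assume xy: "x \<in> carrier J" "y \<in> carrier J" "x \<oplus>\<^bsub>J\<^esub> u \<otimes>\<^bsub>J\<^esub> x = y \<oplus>\<^bsub>J\<^esub> u \<otimes>\<^bsub>J\<^esub> y"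
  have "u \<otimes>\<^bsub>J_circ\<^esub> x = u \<otimes>\<^bsub>J_circ\<^esub> y"
    using xy assms J_mult_closed by (simp add: J_circ_simps M.a_assoc)
  then show "x = y"
    using C.Units_l_cancel[of u x y] xy assms by (simp add: C.Units_eq J_circ_simps(1))
qed

lemma inj_on_J_plus_mult_right:
  assumes "v \<in> carrier J"
  shows "inj_on (\<lambda>x. x \<oplus>\<^bsub>J\<^esub> x \<otimes>\<^bsub>J\<^esub> v) (carrier J)"
proof (rule inj_onI)
  interpret C: group J_circ by (rule group_J_circ)
  fix x y assume xy: "x \<in> carrier J" "y \<in> carrier J" "x \<oplus>\<^bsub>J\<^esub> x \<otimes>\<^bsub>J\<^esub> v = y \<oplus>\<^bsub>J\<^esub> y \<otimes>\<^bsub>J\<^esub> v"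
  have "z \<otimes>\<^bsub>J_circ\<^esub> v = v \<oplus>\<^bsub>J\<^esub> (z \<oplus>\<^bsub>J\<^esub> z \<otimes>\<^bsub>J\<^esub> v)" if "z \<in> carrier J" for z
    using that assms J_mult_closed by (simp add: J_circ_simps M.a_ac)
  then have "x \<otimes>\<^bsub>J_circ\<^esub> v = y \<otimes>\<^bsub>J_circ\<^esub> v"
    using xy by simp
  then show "x = y"
    using C.right_cancel[of v x y] xy assms by (simp add: J_circ_simps(1))
qed

section \<open>The group algebra kH and its actions on J\<close>

lemma kH_single_closed: "h \<in> carrier H \<Longrightarrow> kH_single h \<in> kH_carrier"
  by (auto simp: kH_carrier_def kH_single_def)

lemma kH_single_inject: "kH_single h = kH_single k \<longleftrightarrow> h = k"
  by (auto simp: kH_single_def fun_eq_iff split: if_splits)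

lemma kH_mult_single_left:
  assumes f: "f \<in> kH_carrier" and t: "t \<in> carrier H" and x: "x \<in> carrier H"
  shows "kH_mult (kH_single t) f x = f (inv\<^bsub>H\<^esub> t \<otimes>\<^bsub>H\<^esub> x)"
proof -
  have fc: "f y \<in> carrier K" if "y \<in> carrier H" for y
    using f that by (auto simp: kH_carrier_def)
  have "kH_mult (kH_single t) f x =
      (\<Oplus>\<^bsub>K\<^esub>y\<in>carrier H. if t = y then f (inv\<^bsub>H\<^esub> y \<otimes>\<^bsub>H\<^esub> x) else \<zero>\<^bsub>K\<^esub>)"
    unfolding kH_mult_def using x fc by (auto intro!: R.finsum_cong' simp: kH_single_def)
  also have "\<dots> = f (inv\<^bsub>H\<^esub> t \<otimes>\<^bsub>H\<^esub> x)"
    using t finite_H by (rule R.finsum_singleton) (use fc x in auto)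
  finally show ?thesis .
qed

lemma kH_mult_single_right:
  assumes f: "f \<in> kH_carrier" and t: "t \<in> carrier H" and x: "x \<in> carrier H"
  shows "kH_mult f (kH_single t) x = f (x \<otimes>\<^bsub>H\<^esub> inv\<^bsub>H\<^esub> t)"
proof -
  have fc: "f y \<in> carrier K" if "y \<in> carrier H" for y
    using f that by (auto simp: kH_carrier_def)
  \<comment> \<open>The convolution is indexed by its left factor y, so a single t on the right
    selects the index y = x t^-1.\<close>
  have eq: "inv\<^bsub>H\<^esub> y \<otimes>\<^bsub>H\<^esub> x = t \<longleftrightarrow> x \<otimes>\<^bsub>H\<^esub> inv\<^bsub>H\<^esub> t = y" if "y \<in> carrier H" for y
    using that t x by (metis H.inv_closed H.inv_solve_left H.inv_solve_right H.m_closed)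
  have "kH_mult f (kH_single t) x =
      (\<Oplus>\<^bsub>K\<^esub>y\<in>carrier H. if x \<otimes>\<^bsub>H\<^esub> inv\<^bsub>H\<^esub> t = y then f y else \<zero>\<^bsub>K\<^esub>)"
    unfolding kH_mult_def using x fc eq by (auto intro!: R.finsum_cong' simp: kH_single_def)
  also have "\<dots> = f (x \<otimes>\<^bsub>H\<^esub> inv\<^bsub>H\<^esub> t)"
    by (rule R.finsum_singleton) (use fc x t finite_H in auto)
  finally show ?thesis .
qed

lemma kH_mult_one_left:
  assumes "f \<in> kH_carrier"
  shows "kH_mult (kH_single \<one>\<^bsub>H\<^esub>) f = f"
proof
  fix x
  show "kH_mult (kH_single \<one>\<^bsub>H\<^esub>) f x = f x"
  proof (cases "x \<in> carrier H")
    case True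
    then show ?thesis
      using assms kH_mult_single_left[of f "\<one>\<^bsub>H\<^esub>" x] by simp
  next
    case False
    then show ?thesis
      using assms by (simp add: kH_mult_def kH_carrier_def)
  qed
qed

text \<open>For g = h + x the factor g - 1 in \<open>R\<close> has kH-component h - 1, a difference
  of group elements. Translation by H preserves such differences, so this family carries the
  kH-component through the whole product.\<close>

definition kH_diff :: "'h \<Rightarrow> 'h \<Rightarrow> 'h \<Rightarrow> 'k" where
  "kH_diff h k = (\<lambda>y. kH_single h y \<ominus>\<^bsub>K\<^esub> kH_single k y)"

lemma kH_diff_closed: "\<lbrakk>h \<in> carrier H; k \<in> carrier H\<rbrakk> \<Longrightarrow> kH_diff h k \<in> kH_carrier"
  by (auto simp: kH_carrier_def kH_diff_def kH_single_def)

text \<open>Every value of \<open>kH_single\<close> is zero or one, hence in K, so the cancellation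
  is valid at every y, inside and outside H.\<close>

lemma kH_diff_add: "(\<lambda>y. kH_diff h k y \<oplus>\<^bsub>K\<^esub> kH_single k y) = kH_single h"
  by (auto simp: fun_eq_iff kH_diff_def kH_single_def R.minus_eq R.r_neg R.l_neg)

lemma kH_mult_single_diff:
  assumes "t \<in> carrier H" "h \<in> carrier H" "k \<in> carrier H"
  shows "kH_mult (kH_single t) (kH_diff h k) = kH_diff (t \<otimes>\<^bsub>H\<^esub> h) (t \<otimes>\<^bsub>H\<^esub> k)"
proof
  fix x
  show "kH_mult (kH_single t) (kH_diff h k) x = kH_diff (t \<otimes>\<^bsub>H\<^esub> h) (t \<otimes>\<^bsub>H\<^esub> k) x"
  proof (cases "x \<in> carrier H")
    case True
    have "inv\<^bsub>H\<^esub> t \<otimes>\<^bsub>H\<^esub> x = s \<longleftrightarrow> x = t \<otimes>\<^bsub>H\<^esub> s" if "s \<in> carrier H" for s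
      using that assms(1) True by (metis H.inv_solve_left')
    with assms True show ?thesis
      unfolding kH_mult_single_left[OF kH_diff_closed[OF assms(2,3)] assms(1) True]
      by (simp add: kH_diff_def kH_single_def)
  qed (use assms in \<open>auto simp: kH_mult_def kH_diff_def kH_single_def R.minus_eq R.r_neg\<close>)
qed

lemma kH_mult_diff_single:
  assumes "t \<in> carrier H" "h \<in> carrier H" "k \<in> carrier H"
  shows "kH_mult (kH_diff h k) (kH_single t) = kH_diff (h \<otimes>\<^bsub>H\<^esub> t) (k \<otimes>\<^bsub>H\<^esub> t)"
proof
  fix x
  show "kH_mult (kH_diff h k) (kH_single t) x = kH_diff (h \<otimes>\<^bsub>H\<^esub> t) (k \<otimes>\<^bsub>H\<^esub> t) x"
  proof (cases "x \<in> carrier H")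
    case True
    have "x \<otimes>\<^bsub>H\<^esub> inv\<^bsub>H\<^esub> t = s \<longleftrightarrow> x = s \<otimes>\<^bsub>H\<^esub> t" if "s \<in> carrier H" for s
      using that assms(1) True by (metis H.inv_solve_right')
    with assms True show ?thesis
      unfolding kH_mult_single_right[OF kH_diff_closed[OF assms(2,3)] assms(1) True]
      by (simp add: kH_diff_def kH_single_def)
  qed (use assms in \<open>auto simp: kH_mult_def kH_diff_def kH_single_def R.minus_eq R.r_neg\<close>)
qed

lemma kH_la_closed:
  assumes "f \<in> kH_carrier" "x \<in> carrier J"
  shows "kH_la f x \<in> carrier J"
  unfolding kH_la_def using assms la_closed
  by (intro M.finsum_closed) (auto simp: kH_carrier_def)

lemma kH_ra_closed:
  assumes "f \<in> kH_carrier" "x \<in> carrier J"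
  shows "kH_ra x f \<in> carrier J"
  unfolding kH_ra_def using assms ra_closed
  by (intro M.finsum_closed) (auto simp: kH_carrier_def)

lemma kH_la_add:
  assumes "f \<in> kH_carrier" "g \<in> kH_carrier" "x \<in> carrier J"
  shows "kH_la (\<lambda>h. f h \<oplus>\<^bsub>K\<^esub> g h) x = kH_la f x \<oplus>\<^bsub>J\<^esub> kH_la g x"
proof -
  have "kH_la (\<lambda>h. f h \<oplus>\<^bsub>K\<^esub> g h) x =
      (\<Oplus>\<^bsub>J\<^esub>h\<in>carrier H. f h \<odot>\<^bsub>J\<^esub> la h x \<oplus>\<^bsub>J\<^esub> g h \<odot>\<^bsub>J\<^esub> la h x)"
    unfolding kH_la_def using assms la_closed
    by (intro M.finsum_cong') (auto simp: kH_carrier_def smult_l_distr)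
  also have "\<dots> = kH_la f x \<oplus>\<^bsub>J\<^esub> kH_la g x"
    unfolding kH_la_def using assms la_closed
    by (intro M.finsum_addf) (auto simp: kH_carrier_def)
  finally show ?thesis .
qed

lemma kH_ra_add:
  assumes "f \<in> kH_carrier" "g \<in> kH_carrier" "x \<in> carrier J"
  shows "kH_ra x (\<lambda>h. f h \<oplus>\<^bsub>K\<^esub> g h) = kH_ra x f \<oplus>\<^bsub>J\<^esub> kH_ra x g"
proof -
  have "kH_ra x (\<lambda>h. f h \<oplus>\<^bsub>K\<^esub> g h) =
      (\<Oplus>\<^bsub>J\<^esub>h\<in>carrier H. f h \<odot>\<^bsub>J\<^esub> ra x h \<oplus>\<^bsub>J\<^esub> g h \<odot>\<^bsub>J\<^esub> ra x h)"
    unfolding kH_ra_def using assms ra_closed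
    by (intro M.finsum_cong') (auto simp: kH_carrier_def smult_l_distr)
  also have "\<dots> = kH_ra x f \<oplus>\<^bsub>J\<^esub> kH_ra x g"
    unfolding kH_ra_def using assms ra_closed
    by (intro M.finsum_addf) (auto simp: kH_carrier_def)
  finally show ?thesis .
qed

text \<open>Additivity applied to h = (h - k) + k reduces the claim to the action of single group
  elements, followed by cancellation in J.\<close>

lemma kH_la_diff:
  assumes "h \<in> carrier H" "k \<in> carrier H" "x \<in> carrier J"
  shows "kH_la (kH_diff h k) x = la h x \<ominus>\<^bsub>J\<^esub> la k x"
proof -
  have "la h x = kH_la (kH_diff h k) x \<oplus>\<^bsub>J\<^esub> la k x"
    using kH_la_add[of "kH_diff h k" "kH_single k" x] assms
    by (simp add: kH_diff_add kH_diff_closed kH_single_closed kH_la_single)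
  then show ?thesis
    using assms la_closed kH_la_closed[OF kH_diff_closed]
    by (simp add: M.minus_eq M.a_assoc M.r_neg)
qed

lemma kH_ra_diff:
  assumes "h \<in> carrier H" "k \<in> carrier H" "x \<in> carrier J"
  shows "kH_ra x (kH_diff h k) = ra x h \<ominus>\<^bsub>J\<^esub> ra x k"
proof -
  have "ra x h = kH_ra x (kH_diff h k) \<oplus>\<^bsub>J\<^esub> ra x k"
    using kH_ra_add[of "kH_diff h k" "kH_single k" x] assms
    by (simp add: kH_diff_add kH_diff_closed kH_single_closed kH_ra_single)
  then show ?thesis
    using assms ra_closed kH_ra_closed[OF kH_diff_closed]
    by (simp add: M.minus_eq M.a_assoc M.r_neg)
qed

section \<open>Subtraction and inverses in \<open>A\<close>\<close>

text \<open>\<open>R\<close> subtracts 1 in \<open>A\<close>. Once addition is a group, that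
  difference is pinned down by adding 1 back.\<close>

lemma abelian_group_A: "abelian_group A"
proof (rule abelian_groupI)
  fix a assume "a \<in> carrier A"
  then obtain f x where a: "a = (f, x)" "f \<in> kH_carrier" "x \<in> carrier J"
    by (auto simp: A_carrier)
  have "((\<lambda>h. \<ominus>\<^bsub>K\<^esub> f h), \<ominus>\<^bsub>J\<^esub> x) \<in> carrier A"
    using a by (auto simp: A_carrier kH_carrier_def)
  moreover have "\<ominus>\<^bsub>K\<^esub> f h \<oplus>\<^bsub>K\<^esub> f h = \<zero>\<^bsub>K\<^esub>" for h
    using a(2) by (cases "h \<in> carrier H") (auto simp: kH_carrier_def R.l_neg)
  then have "((\<lambda>h. \<ominus>\<^bsub>K\<^esub> f h), \<ominus>\<^bsub>J\<^esub> x) \<oplus>\<^bsub>A\<^esub> a = \<zero>\<^bsub>A\<^esub>"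
    using a by (simp add: A_def M.l_neg)
  ultimately show "\<exists>y\<in>carrier A. y \<oplus>\<^bsub>A\<^esub> a = \<zero>\<^bsub>A\<^esub>" ..
next
  \<comment> \<open>Elements of kH vanish outside H, so their values lie in K everywhere and the
    laws of K apply pointwise.\<close>
  have c: "f h \<in> carrier K" if "f \<in> kH_carrier" for f h
    using that by (cases "h \<in> carrier H") (auto simp: kH_carrier_def)
  show "a \<oplus>\<^bsub>A\<^esub> b \<oplus>\<^bsub>A\<^esub> d = a \<oplus>\<^bsub>A\<^esub> (b \<oplus>\<^bsub>A\<^esub> d)"
    if "a \<in> carrier A" "b \<in> carrier A" "d \<in> carrier A" for a b d
    using that c by (auto simp: A_def R.a_assoc M.a_assoc)
  show "a \<oplus>\<^bsub>A\<^esub> b = b \<oplus>\<^bsub>A\<^esub> a" if "a \<in> carrier A" "b \<in> carrier A" for a b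
    using that c by (auto simp: A_def R.a_comm M.a_comm)
  show "\<zero>\<^bsub>A\<^esub> \<oplus>\<^bsub>A\<^esub> a = a" if "a \<in> carrier A" for a
    using that c by (auto simp: A_def)
qed (auto simp: A_def kH_carrier_def)

lemma A_minus_one:
  assumes "h \<in> carrier H" "x \<in> carrier J"
  shows "(kH_single h, x) \<ominus>\<^bsub>A\<^esub> \<one>\<^bsub>A\<^esub> = (kH_diff h \<one>\<^bsub>H\<^esub>, x)"
proof -
  interpret A: abelian_group A by (rule abelian_group_A)
  have "(kH_diff h \<one>\<^bsub>H\<^esub>, x) \<oplus>\<^bsub>A\<^esub> \<one>\<^bsub>A\<^esub> = (kH_single h, x)"
    using assms by (simp add: A_one A_add kH_diff_add)
  moreover have "(kH_diff h \<one>\<^bsub>H\<^esub>, x) \<in> carrier A" "\<one>\<^bsub>A\<^esub> \<in> carrier A"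
    using assms by (simp_all add: A_carrier A_one kH_diff_closed kH_single_closed)
  ultimately show ?thesis
    by (metis A.add.inv_closed A.a_assoc A.r_neg A.r_zero A.minus_eq)
qed

text \<open>The inverse is a definite description over \<open>carrier A\<close>, so existence and
  uniqueness are both checked in coordinates: the kH-component by translation, the J-component by
  injectivity of the left action.\<close>

lemma inv_of_H:
  assumes t: "t \<in> carrier H"
  shows "inv\<^bsub>A\<^esub> (of_H t) = (kH_single (inv\<^bsub>H\<^esub> t), \<zero>\<^bsub>J\<^esub>)"
  unfolding m_inv_def[of A]
proof (rule the_equality)
  show "(kH_single (inv\<^bsub>H\<^esub> t), \<zero>\<^bsub>J\<^esub>) \<in> carrier A \<and>
      of_H t \<otimes>\<^bsub>A\<^esub> (kH_single (inv\<^bsub>H\<^esub> t), \<zero>\<^bsub>J\<^esub>) = \<one>\<^bsub>A\<^esub> \<and>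
      (kH_single (inv\<^bsub>H\<^esub> t), \<zero>\<^bsub>J\<^esub>) \<otimes>\<^bsub>A\<^esub> of_H t = \<one>\<^bsub>A\<^esub>"
    using t by (simp add: A_carrier A_one A_mult of_H_def kH_single_closed kH_single_mult
      kH_la_single kH_ra_single la_zero ra_zero J_mult_zero)
next
  fix y assume y: "y \<in> carrier A \<and> of_H t \<otimes>\<^bsub>A\<^esub> y = \<one>\<^bsub>A\<^esub> \<and> y \<otimes>\<^bsub>A\<^esub> of_H t = \<one>\<^bsub>A\<^esub>"
  then obtain f z where fz: "y = (f, z)" "f \<in> kH_carrier" "z \<in> carrier J"
    by (auto simp: A_carrier)
  have "kH_mult (kH_single t) f = kH_single \<one>\<^bsub>H\<^esub>"
    using y fz by (simp add: A_one A_mult of_H_def)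
  have f: "f = kH_single (inv\<^bsub>H\<^esub> t)"
  proof
    fix x
    show "f x = kH_single (inv\<^bsub>H\<^esub> t) x"
    proof (cases "x \<in> carrier H")
      case True
      have inv_iff: "t \<otimes>\<^bsub>H\<^esub> x = \<one>\<^bsub>H\<^esub> \<longleftrightarrow> x = inv\<^bsub>H\<^esub> t"
        using True t by (metis H.inv_comm H.inv_equality H.r_inv)
      \<comment> \<open>Evaluating at t x undoes the translation by t, so the kH-component of the
        inverse equation determines f.\<close>
      have "f x = kH_mult (kH_single t) f (t \<otimes>\<^bsub>H\<^esub> x)"
        using True t fz by (simp add: kH_mult_single_left H.m_assoc[symmetric])
      also have "\<dots> = kH_single \<one>\<^bsub>H\<^esub> (t \<otimes>\<^bsub>H\<^esub> x)"
        using \<open>kH_mult (kH_single t) f = kH_single \<one>\<^bsub>H\<^esub>\<close> by simp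
      also have "\<dots> = kH_single (inv\<^bsub>H\<^esub> t) x"
        using inv_iff by (simp add: kH_single_def)
      finally show ?thesis .
    qed (use fz t in \<open>auto simp: kH_carrier_def kH_single_def\<close>)
  qed
  have "la t z = \<zero>\<^bsub>J\<^esub>"
    using y fz t la_closed unfolding f
    by (simp add: A_one A_mult of_H_def kH_la_single kH_ra_single ra_zero J_mult_zero)
  then have "z = \<zero>\<^bsub>J\<^esub>"
    using inj_onD[OF inj_on_la[OF t], of z "\<zero>\<^bsub>J\<^esub>"] fz t by (simp add: la_zero)
  with fz f show "y = (kH_single (inv\<^bsub>H\<^esub> t), \<zero>\<^bsub>J\<^esub>)" by simp
qed

text \<open>On pairs with kH-component 1 the product of \<open>A\<close> is the circle product. Any
  inverse in \<open>A\<close> again has kH-component 1, which reduces the question to inverses in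
  \<open>J_circ\<close>.\<close>

lemma inv_N:
  assumes v: "v \<in> carrier J"
  shows "inv\<^bsub>A\<^esub> (kH_single \<one>\<^bsub>H\<^esub>, v) = (kH_single \<one>\<^bsub>H\<^esub>, inv\<^bsub>J_circ\<^esub> v)"
proof -
  interpret C: group J_circ by (rule group_J_circ)
  have mult: "(kH_single \<one>\<^bsub>H\<^esub>, x) \<otimes>\<^bsub>A\<^esub> (kH_single \<one>\<^bsub>H\<^esub>, y) =
      (kH_single \<one>\<^bsub>H\<^esub>, x \<otimes>\<^bsub>J_circ\<^esub> y)" if "x \<in> carrier J" "y \<in> carrier J" for x y
    using that J_mult_closed
    by (simp add: A_mult kH_single_mult kH_la_single kH_ra_single la_one ra_one
      J_circ_simps M.a_ac)
  have v': "inv\<^bsub>J_circ\<^esub> v \<in> carrier J"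
    using v C.inv_closed[of v] by (simp add: J_circ_simps)
  show ?thesis
    unfolding m_inv_def[of A]
  proof (rule the_equality)
    show "(kH_single \<one>\<^bsub>H\<^esub>, inv\<^bsub>J_circ\<^esub> v) \<in> carrier A \<and>
        (kH_single \<one>\<^bsub>H\<^esub>, v) \<otimes>\<^bsub>A\<^esub> (kH_single \<one>\<^bsub>H\<^esub>, inv\<^bsub>J_circ\<^esub> v) = \<one>\<^bsub>A\<^esub> \<and>
        (kH_single \<one>\<^bsub>H\<^esub>, inv\<^bsub>J_circ\<^esub> v) \<otimes>\<^bsub>A\<^esub> (kH_single \<one>\<^bsub>H\<^esub>, v) = \<one>\<^bsub>A\<^esub>"
      using v v' C.l_inv[of v] C.r_inv[of v]
      by (simp add: mult A_carrier A_one kH_single_closed J_circ_simps(1,3))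
  next
    fix y assume y: "y \<in> carrier A \<and> (kH_single \<one>\<^bsub>H\<^esub>, v) \<otimes>\<^bsub>A\<^esub> y = \<one>\<^bsub>A\<^esub> \<and>
      y \<otimes>\<^bsub>A\<^esub> (kH_single \<one>\<^bsub>H\<^esub>, v) = \<one>\<^bsub>A\<^esub>"
    then obtain f z where fz: "y = (f, z)" "f \<in> kH_carrier" "z \<in> carrier J"
      by (auto simp: A_carrier)
    have f: "f = kH_single \<one>\<^bsub>H\<^esub>"
      using y fz by (simp add: A_one A_mult kH_mult_one_left)
    have "z \<otimes>\<^bsub>J_circ\<^esub> v = \<one>\<^bsub>J_circ\<^esub>"
      using y fz v unfolding f by (simp add: mult A_one J_circ_simps(3))
    then have "inv\<^bsub>J_circ\<^esub> v = z"
      using C.inv_equality[of z v] v fz by (simp add: J_circ_simps(1))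
    with fz f show "y = (kH_single \<one>\<^bsub>H\<^esub>, inv\<^bsub>J_circ\<^esub> v)" by simp
  qed
qed

section \<open>Carriers and orders of G, N and the acting group\<close>

lemma of_H_add_of_J:
  assumes "x \<in> carrier J"
  shows "of_H h \<oplus>\<^bsub>A\<^esub> of_J x = (kH_single h, x)"
  using assms by (auto simp: of_H_def of_J_def A_add kH_single_def)

text \<open>General \<open>S\<close> and \<open>X\<close> let one computation serve G, N and the
  subgroup G'.\<close>

lemma sums_of_H_of_J:
  assumes "X \<subseteq> carrier J"
  shows "{of_H h \<oplus>\<^bsub>A\<^esub> of_J x | h x. h \<in> S \<and> x \<in> X} = kH_single ` S \<times> X"
proof -
  have "{of_H h \<oplus>\<^bsub>A\<^esub> of_J x | h x. h \<in> S \<and> x \<in> X} =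
      (\<lambda>(h, x). of_H h \<oplus>\<^bsub>A\<^esub> of_J x) ` (S \<times> X)"
    by auto
  also have "\<dots> = (\<lambda>(h, x). (kH_single h, x)) ` (S \<times> X)"
    using assms by (intro image_cong) (auto simp: of_H_add_of_J)
  also have "\<dots> = kH_single ` S \<times> X"
    by auto
  finally show ?thesis .
qed

lemma G_carrier: "carrier G = kH_single ` carrier H \<times> carrier J"
  using sums_of_H_of_J[of "carrier J" "carrier H"] by (simp add: G_def)

lemma N_eq: "N = {kH_single \<one>\<^bsub>H\<^esub>} \<times> carrier J"
  using sums_of_H_of_J[of "carrier J" "{\<one>\<^bsub>H\<^esub>}"] by (simp add: N_def A_one of_H_def)

lemma G_tilde_carrier: "carrier G_tilde = carrier H \<times> N \<times> N"
  by (simp add: G_tilde_def)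

lemma order_G: "order G = order H * card (carrier J)"
  by (simp add: order_def G_carrier card_cartesian_product card_image inj_on_def kH_single_inject)

lemma finite_G: "finite (carrier G)"
  by (simp add: G_carrier finite_H finite_J)

text \<open>With |G| = |H||J| and |N| = |J|, both sides equal |H|^2 |J|^2. This is what makes the
  normalising factor of \<open>SInd\<close> collapse.\<close>

lemma card_G_tilde: "order H * card (carrier G_tilde) = order G * order G"
  by (simp add: G_tilde_carrier order_G N_eq card_cartesian_product order_def[of H])

section \<open>The maps \<open>R \<tau>\<close> in coordinates and their bijectivity\<close>

text \<open>Here \<open>y\<close> is the J-component of ta(g-1), \<open>w\<close> that of b^-1, and
  the argument of the outer \<open>ra\<close> that of ta(g-1)b^-1. For fixed h and \<tau> the result
  is built from x by additive maps and translations, the form needed for injectivity.\<close>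

lemma R_eq:
  assumes t: "t \<in> carrier H" and u: "u \<in> carrier J" and v: "v \<in> carrier J"
    and h: "h \<in> carrier H" and x: "x \<in> carrier J"
  defines "w \<equiv> inv\<^bsub>J_circ\<^esub> v"
  defines "y \<equiv> la t (x \<oplus>\<^bsub>J\<^esub> u \<otimes>\<^bsub>J\<^esub> x) \<oplus>\<^bsub>J\<^esub> (ra (la t u) h \<ominus>\<^bsub>J\<^esub> la t u)"
  shows "R (t, (kH_single \<one>\<^bsub>H\<^esub>, u), (kH_single \<one>\<^bsub>H\<^esub>, v)) (kH_single h, x) =
    (kH_single h, ra ((y \<oplus>\<^bsub>J\<^esub> y \<otimes>\<^bsub>J\<^esub> w) \<oplus>\<^bsub>J\<^esub> (la (t \<otimes>\<^bsub>H\<^esub> h) w \<ominus>\<^bsub>J\<^esub> la t w)) (inv\<^bsub>H\<^esub> t))"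
    (is "_ = (_, ra ?z _)")
proof -
  interpret C: group J_circ by (rule group_J_circ)
  have w: "w \<in> carrier J"
    using v C.inv_closed[of v] by (simp add: w_def J_circ_simps)
  have y: "y \<in> carrier J"
    using assms la_closed ra_closed J_mult_closed by (simp add: y_def)
  have z: "?z \<in> carrier J"
    using y w t h la_closed J_mult_closed by simp
  have 1: "of_H t \<otimes>\<^bsub>A\<^esub> (kH_single \<one>\<^bsub>H\<^esub>, u) = (kH_single t, la t u)"
    using t u la_closed
    by (simp add: of_H_def A_mult kH_single_mult kH_la_single kH_ra_single ra_zero J_mult_zero)
  have 2: "(kH_single t, la t u) \<otimes>\<^bsub>A\<^esub> (kH_diff h \<one>\<^bsub>H\<^esub>, x) = (kH_diff (t \<otimes>\<^bsub>H\<^esub> h) t, y)"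
    using t u h x la_closed ra_closed J_mult_closed
    by (simp add: A_mult kH_mult_single_diff kH_la_single kH_ra_diff ra_one y_def la_add
      la_J_mult M.a_ac)
  have 3: "(kH_diff (t \<otimes>\<^bsub>H\<^esub> h) t, y) \<otimes>\<^bsub>A\<^esub> (kH_single \<one>\<^bsub>H\<^esub>, w) = (kH_diff (t \<otimes>\<^bsub>H\<^esub> h) t, ?z)"
    using t h w y la_closed ra_closed J_mult_closed
    by (simp add: A_mult kH_mult_diff_single kH_ra_single kH_la_diff ra_one M.a_ac)
  \<comment> \<open>Commutativity of H makes conjugation by t trivial on the H-component.\<close>
  have "t \<otimes>\<^bsub>H\<^esub> h \<otimes>\<^bsub>H\<^esub> inv\<^bsub>H\<^esub> t = h"
    using t h by (simp add: H.m_comm[of t h] H.m_assoc)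
  then have 4: "(kH_diff (t \<otimes>\<^bsub>H\<^esub> h) t, ?z) \<otimes>\<^bsub>A\<^esub> (kH_single (inv\<^bsub>H\<^esub> t), \<zero>\<^bsub>J\<^esub>) =
      (kH_diff h \<one>\<^bsub>H\<^esub>, ra ?z (inv\<^bsub>H\<^esub> t))"
    using t h z ra_closed
    by (simp add: A_mult kH_mult_diff_single kH_ra_single kH_la_diff la_zero J_mult_zero
      M.minus_eq)
  interpret A: abelian_group A by (rule abelian_group_A)
  have "(kH_diff h \<one>\<^bsub>H\<^esub>, ra ?z (inv\<^bsub>H\<^esub> t)) \<in> carrier A" "\<one>\<^bsub>A\<^esub> \<in> carrier A"
    using t h z ra_closed by (simp_all add: A_carrier A_one kH_diff_closed kH_single_closed)
  then have "\<one>\<^bsub>A\<^esub> \<oplus>\<^bsub>A\<^esub> (kH_diff h \<one>\<^bsub>H\<^esub>, ra ?z (inv\<^bsub>H\<^esub> t)) = (kH_single h, ra ?z (inv\<^bsub>H\<^esub> t))"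
    using t z ra_closed by (subst A.a_comm) (simp_all add: A_one A_add kH_diff_add)
  then show ?thesis
    by (simp add: R_def A_minus_one[OF h x] inv_N[OF v] inv_of_H[OF t] 1 2 3 4
      flip: w_def)
qed

text \<open>G is finite, so an injective self-map suffices. The layers of \<open>R_eq\<close> are
  peeled off from the outside, each being injective on J.\<close>

lemma R_bij_betw:
  assumes "\<tau> \<in> carrier G_tilde"
  shows "bij_betw (R \<tau>) (carrier G) (carrier G)"
proof -
  interpret C: group J_circ by (rule group_J_circ)
  obtain t u v where \<tau>: "\<tau> = (t, (kH_single \<one>\<^bsub>H\<^esub>, u), (kH_single \<one>\<^bsub>H\<^esub>, v))"
    and t: "t \<in> carrier H" and u: "u \<in> carrier J" and v: "v \<in> carrier J"
    using assms by (auto simp: G_tilde_carrier N_eq)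
  have w: "inv\<^bsub>J_circ\<^esub> v \<in> carrier J"
    using v C.inv_closed[of v] by (simp add: J_circ_simps)
  note closed = la_closed ra_closed J_mult_closed
  have into: "R \<tau> ` carrier G \<subseteq> carrier G"
    using t u v w closed by (auto simp: G_carrier \<tau> R_eq)
  have "inj_on (R \<tau>) (carrier G)"
  proof (rule inj_onI)
    fix g1 g2 assume g: "g1 \<in> carrier G" "g2 \<in> carrier G" and eq: "R \<tau> g1 = R \<tau> g2"
    then obtain h x h2 x2 where g1: "g1 = (kH_single h, x)" "h \<in> carrier H" "x \<in> carrier J"
      and g2: "g2 = (kH_single h2, x2)" "h2 \<in> carrier H" "x2 \<in> carrier J"
      by (auto simp: G_carrier)
    \<comment> \<open>\<open>R \<tau>\<close> keeps the kH-component, so both points share h, and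
      with it the constants \<open>c\<close> and \<open>d\<close>.\<close>
    have h2: "h2 = h"
      using eq t u v g1 g2 by (simp add: \<tau> R_eq kH_single_inject)
    define w where "w = inv\<^bsub>J_circ\<^esub> v"
    define c where "c = ra (la t u) h \<ominus>\<^bsub>J\<^esub> la t u"
    define d where "d = la (t \<otimes>\<^bsub>H\<^esub> h) w \<ominus>\<^bsub>J\<^esub> la t w"
    define y where "y z = la t (z \<oplus>\<^bsub>J\<^esub> u \<otimes>\<^bsub>J\<^esub> z) \<oplus>\<^bsub>J\<^esub> c" for z
    have cd: "c \<in> carrier J" "d \<in> carrier J" "w \<in> carrier J"
      using t u w g1 closed by (simp_all add: c_def d_def w_def)
    have y: "y x \<in> carrier J" "y x2 \<in> carrier J"
      using t u g1 g2 cd closed by (simp_all add: y_def)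
    \<comment> \<open>The layers are removed in this order: right action of t^-1, translation by
      \<open>d\<close>, right factor 1 + w, translation by \<open>c\<close>, left action of t, left
      factor 1 + u.\<close>
    have "ra (y x \<oplus>\<^bsub>J\<^esub> y x \<otimes>\<^bsub>J\<^esub> w \<oplus>\<^bsub>J\<^esub> d) (inv\<^bsub>H\<^esub> t) =
        ra (y x2 \<oplus>\<^bsub>J\<^esub> y x2 \<otimes>\<^bsub>J\<^esub> w \<oplus>\<^bsub>J\<^esub> d) (inv\<^bsub>H\<^esub> t)"
      using eq R_eq[OF t u v g1(2,3)] R_eq[OF t u v g1(2) g2(3)]
      unfolding \<tau> g1(1) g2(1) h2 y_def c_def d_def w_def by simp
    then have "y x \<oplus>\<^bsub>J\<^esub> y x \<otimes>\<^bsub>J\<^esub> w \<oplus>\<^bsub>J\<^esub> d = y x2 \<oplus>\<^bsub>J\<^esub> y x2 \<otimes>\<^bsub>J\<^esub> w \<oplus>\<^bsub>J\<^esub> d"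
      by (rule inj_onD[OF inj_on_ra[OF H.inv_closed[OF t]]]) (use t y cd closed in auto)
    then have "y x \<oplus>\<^bsub>J\<^esub> y x \<otimes>\<^bsub>J\<^esub> w = y x2 \<oplus>\<^bsub>J\<^esub> y x2 \<otimes>\<^bsub>J\<^esub> w"
      using y cd closed by simp
    then have "y x = y x2"
      by (rule inj_onD[OF inj_on_J_plus_mult_right[OF cd(3)]]) (use y in auto)
    then have "la t (x \<oplus>\<^bsub>J\<^esub> u \<otimes>\<^bsub>J\<^esub> x) = la t (x2 \<oplus>\<^bsub>J\<^esub> u \<otimes>\<^bsub>J\<^esub> x2)"
      using cd t u g1 g2 closed by (simp add: y_def)
    then have "x \<oplus>\<^bsub>J\<^esub> u \<otimes>\<^bsub>J\<^esub> x = x2 \<oplus>\<^bsub>J\<^esub> u \<otimes>\<^bsub>J\<^esub> x2"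
      by (rule inj_onD[OF inj_on_la[OF t]]) (use u g1 g2 closed in auto)
    then have "x = x2"
      by (rule inj_onD[OF inj_on_J_plus_mult_left[OF u]]) (use g1 g2 in auto)
    with g1 g2 h2 show "g1 = g2" by simp
  qed
  then show ?thesis
    using endo_inj_surj[OF finite_G into] by (simp add: bij_betw_def)
qed

section \<open>Superclass functions and the change of variable by \<open>R \<tau>\<close>\<close>

lemma R_one:
  assumes "g \<in> carrier G"
  shows "R \<one>\<^bsub>G_tilde\<^esub> g = g"
proof -
  interpret C: group J_circ by (rule group_J_circ)
  have inv_zero: "inv\<^bsub>J_circ\<^esub> \<zero>\<^bsub>J\<^esub> = \<zero>\<^bsub>J\<^esub>"
    using C.inv_one by (simp add: J_circ_simps(3))
  have minus_zero: "\<ominus>\<^bsub>J\<^esub> \<zero>\<^bsub>J\<^esub> = \<zero>\<^bsub>J\<^esub>"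
    using M.r_neg[of "\<zero>\<^bsub>J\<^esub>"] by simp
  obtain h x where "g = (kH_single h, x)" "h \<in> carrier H" "x \<in> carrier J"
    using assms by (auto simp: G_carrier)
  then show ?thesis
    using R_eq[of "\<one>\<^bsub>H\<^esub>" "\<zero>\<^bsub>J\<^esub>" "\<zero>\<^bsub>J\<^esub>" h x]
    by (simp add: G_tilde_def A_one inv_zero la_zero ra_zero la_one ra_one J_mult_zero
      M.minus_eq minus_zero)
qed

text \<open>An orbit is the set of all images of its base point: it contains
  \<open>R \<tau> g\<close> by definition, and g itself through \<open>R_one\<close>.\<close>

lemma superclass_function_R:
  assumes "superclass_function \<psi>" "\<tau> \<in> carrier G_tilde" "g \<in> carrier G"
  shows "\<psi> (R \<tau> g) = \<psi> g"
proof -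
  have "\<one>\<^bsub>G_tilde\<^esub> \<in> carrier G_tilde"
    by (simp add: G_tilde_def N_eq A_one)
  then have "g \<in> orbit G_tilde R g"
    using R_one[OF assms(3)] unfolding orbit_def by (intro CollectI exI[of _ "\<one>\<^bsub>G_tilde\<^esub>"]) simp
  moreover have "R \<tau> g \<in> orbit G_tilde R g"
    using assms(2) unfolding orbit_def by blast
  moreover have "orbit G_tilde R g \<in> superclasses"
    using assms(3) unfolding superclasses_def orbits_def by blast
  ultimately show ?thesis
    using assms(1) unfolding superclass_function_def by blast
qed

text \<open>Reindexing along the bijection \<open>R \<tau>\<close> turns the right-hand sum into one
  with \<open>\<psi> (R \<tau> g)\<close>, which invariance replaces by \<open>\<psi> g\<close>. The
  function \<open>f\<close> is arbitrary so that a function extended by zero can be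
  inserted.\<close>

lemma sum_R_superclass_function:
  assumes "superclass_function \<psi>" "\<tau> \<in> carrier G_tilde"
  shows "(\<Sum>g\<in>carrier G. f (R \<tau> g) * cnj (\<psi> g)) = (\<Sum>g\<in>carrier G. f g * cnj (\<psi> g))"
  using sum.reindex_bij_betw[OF R_bij_betw[OF assms(2)], of "\<lambda>g. f g * cnj (\<psi> g)"]
  by (simp add: superclass_function_R[OF assms])

end

section \<open>The subgroup G' and reciprocity\<close>

context triangular_subgroup
begin

text \<open>Passing to H' and J' changes only carriers. Addition and the embeddings
  \<open>of_H\<close> and \<open>of_J\<close> unfold to the ambient ones, so G' consists of the same
  sums inside \<open>A\<close>.\<close>

lemma sub_G_carrier: "carrier (sub_G H' J') = kH_single ` H' \<times> J'"
proof -
  have "J' \<subseteq> carrier J"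
    using J'_subspace by (simp add: subspace_def submodule_def)
  have "carrier (sub_G H' J') = {of_H h \<oplus>\<^bsub>A\<^esub> of_J x | h x. h \<in> H' \<and> x \<in> J'}"
    by (simp add: sub_G_def triangular_data.G_def triangular_data.A_def triangular_data.of_H_def
      triangular_data.of_J_def triangular_data.kH_single_def)
  then show ?thesis
    using sums_of_H_of_J[OF \<open>J' \<subseteq> carrier J\<close>] by simp
qed

lemma sub_G_subset: "carrier (sub_G H' J') \<subseteq> carrier G"
  using J'_subspace subgroup.subset[OF H'_subgroup]
  by (auto simp: sub_G_carrier G_carrier subspace_def submodule_def)

theorem SInd_reciprocity:
  assumes \<psi>: "superclass_function \<psi>"
  shows "scalar_product (SInd H' J' \<phi>) \<psi> = sub_scalar_product H' J' \<phi> (Res H' J' \<psi>)"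
proof -
  let ?G' = "carrier (sub_G H' J')"
  define \<phi>0 where "\<phi>0 g = (if g \<in> ?G' then \<phi> g else 0)" for g
  define c :: complex
    where "c = of_nat (order H) / (of_nat (order G) * of_nat (order (sub_G H' J')))"
  \<comment> \<open>This licenses cancelling |G|, once in the constant and once against the factor
    1/|G| of the scalar product on G.\<close>
  have "order G \<noteq> 0"
    using order_G finite_H finite_J M.zero_closed H.one_closed by (auto simp: order_def)
  have "(\<Sum>g\<in>carrier G. SInd H' J' \<phi> g * cnj (\<psi> g)) =
      c * (\<Sum>g\<in>carrier G. \<Sum>\<tau>\<in>carrier G_tilde. \<phi>0 (R \<tau> g) * cnj (\<psi> g))"
    by (simp add: SInd_def c_def \<phi>0_def sum_distrib_left sum_distrib_right mult.assoc)
  also have "\<dots> = c * (\<Sum>\<tau>\<in>carrier G_tilde. \<Sum>g\<in>carrier G. \<phi>0 (R \<tau> g) * cnj (\<psi> g))"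
    by (subst sum.swap) (rule refl)
  \<comment> \<open>After the exchange of sums, the inner sum no longer depends on \<tau>, leaving
    the number of triples as a factor.\<close>
  also have "\<dots> = c * of_nat (card (carrier G_tilde)) * (\<Sum>g\<in>carrier G. \<phi>0 g * cnj (\<psi> g))"
    by (simp add: sum_R_superclass_function[OF \<psi>])
  also have "(\<Sum>g\<in>carrier G. \<phi>0 g * cnj (\<psi> g)) = (\<Sum>g\<in>?G'. \<phi> g * cnj (\<psi> g))"
    using finite_G sub_G_subset by (intro sum.mono_neutral_cong_right) (auto simp: \<phi>0_def)
  \<comment> \<open>Multiplying \<open>c\<close> by the number of triples gives |G|^2 / (|G||G'|),
    by \<open>card_G_tilde\<close>.\<close>
  also have "c * of_nat (card (carrier G_tilde)) = of_nat (order G) / of_nat (order (sub_G H' J'))"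
    using \<open>order G \<noteq> 0\<close> card_G_tilde[folded of_nat_eq_iff[where 'a = complex]]
    by (simp add: c_def)
  finally show ?thesis
    using \<open>order G \<noteq> 0\<close>
    by (simp add: scalar_product_def sub_scalar_product_def triangular_data.scalar_product_def
      Res_def flip: sub_G_def)
qed

end

theorem theorem5p1:
  fixes K :: "('k, 'm) ring_scheme"
    and H :: "('h, 'n) monoid_scheme"
    and J :: "('k, 'j, 'p) module_scheme"
    and la :: "'h \<Rightarrow> 'j \<Rightarrow> 'j"
    and ra :: "'j \<Rightarrow> 'h \<Rightarrow> 'j"
    and H' :: "'h set" and J' :: "'j set"
    and \<phi> \<psi> :: "('h \<Rightarrow> 'k) \<times> 'j \<Rightarrow> complex"
  assumes "triangular_type K H J la ra"
    and "triangular_subgroup K H J la ra H' J'"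
    and "triangular_data.sub_superclass_function K H J la ra H' J' \<phi>"
    and "triangular_data.superclass_function K H J la ra \<psi>"
  shows "triangular_data.scalar_product K H J la ra
           (triangular_data.SInd K H J la ra H' J' \<phi>) \<psi>
       = triangular_data.sub_scalar_product K H J la ra H' J'
           \<phi> (triangular_data.Res K H J la ra H' J' \<psi>)"
  using assms(2,4) by (rule triangular_subgroup.SInd_reciprocity)

end
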